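(* Let $R$ be a finite ring. Then $R$ is commutative if and only if $R$ is a $1$-centralizer ring, i.e. $|\operatorname{Cent}(R)| = 1$.
   Context: Rings are associative and not assumed to have a unity. For $r \in R$, the centralizer of $r$ is the subring $C(r) = \{s \in R : rs = sr\}$, and $\operatorname{Cent}(R) = \{C(r) : r \in R\}$ is the set of all distinct centralizers. For a positive integer $n$, $R$ is an $n$-centralizer ring if $|\operatorname{Cent}(R)| = n$. *)

theory Defs
  imports Main
begin

(* The type class ring is that of associative rings without a unity. *)

definition centralizer :: "'a::ring \<Rightarrow> 'a set" where
  "centralizer r = {s. r * s = s * r}"

definition Cent :: "'a::ring itself \<Rightarrow> 'a set set" where
  "Cent _ = range (centralizer :: 'a \<Rightarrow> 'a set)"

(* The restriction to positive n also rules out the convention that card is 0 on infinite sets. *)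
definition n_centralizer_ring :: "nat \<Rightarrow> 'a::ring itself \<Rightarrow> bool" where
  "n_centralizer_ring n R \<longleftrightarrow> n > 0 \<and> card (Cent R) = n"

definition commutative_ring :: "'a::ring itself \<Rightarrow> bool" where
  "commutative_ring _ \<longleftrightarrow> (\<forall>x y :: 'a. x * y = y * x)"

end

theory Submission imports Defs begin

text \<open>The centralizer of \<open>0\<close> is always the whole ring. So \<open>Cent\<close> has a single element exactly when
  every centralizer is the whole ring, and this is commutativity.\<close>

lemma centralizer_zero: "centralizer (0 :: 'a::ring) = UNIV"
  by (simp add: centralizer_def)

lemma commutative_ring_iff_centralizer_UNIV:
  "commutative_ring TYPE('a::ring) \<longleftrightarrow> (\<forall>r::'a. centralizer r = UNIV)"
  by (auto simp: commutative_ring_def centralizer_def)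

theorem proposition2p1:
  "commutative_ring TYPE('a::{ring,finite}) \<longleftrightarrow> n_centralizer_ring 1 TYPE('a)"
proof
  assume "commutative_ring TYPE('a)"
  then have "Cent TYPE('a) = {UNIV}"
    by (auto simp: Cent_def commutative_ring_iff_centralizer_UNIV)
  then show "n_centralizer_ring 1 TYPE('a)"
    by (simp add: n_centralizer_ring_def)
next
  assume "n_centralizer_ring 1 TYPE('a)"
  then obtain C where C: "Cent TYPE('a) = {C}"
    by (auto simp: n_centralizer_ring_def card_1_singleton_iff)
  have "centralizer r = UNIV" for r :: 'a
  proof -
    have "centralizer r \<in> Cent TYPE('a)" "centralizer (0::'a) \<in> Cent TYPE('a)"
      by (simp_all add: Cent_def)
    then show ?thesis
      by (simp add: C centralizer_zero)
  qed
  then show "commutative_ring TYPE('a)"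
    by (simp add: commutative_ring_iff_centralizer_UNIV)
qed

end
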